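(* Let $(X_k)_{k\ge 0}$ be a Markov chain on $\Omega$ with transition kernel $\mathsf{M}$ and arbitrary initial law $\mu$ (i.e. $X_0\sim\mu$), where $\mathsf{M}$, $\mathscr{X}$, $\mu_0$ and $\delta_0$ are as in the context. Let $\varphi\in\mathscr{X}$ be real-valued and nonzero, let $a>0$, and set $\hat\mu_n(\varphi)=\frac1n\sum_{k=1}^n\varphi(X_k)$. For every integer $n\ge 1+\frac{\log 100}{-\log(1-\delta_0/13)}$: if $\frac{a}{\lVert\varphi\rVert}\le\frac{\delta_0}{3}$, then \[\mathbb{P}_\mu\big[\lvert\hat\mu_n(\varphi)-\mu_0(\varphi)\rvert\ge a\big]\le 2.488\,\exp\Big(-n\,\frac{\delta_0}{13.44\,\delta_0+8.324}\,\frac{a^2}{\lVert\varphi\rVert^2}\Big);\] and otherwise (i.e. if $\frac{a}{\lVert\varphi\rVert}>\frac{\delta_0}{3}$), \[\mathbb{P}_\mu\big[\lvert\hat\mu_n(\varphi)-\mu_0(\varphi)\rvert\ge a\big]\le 2.624\,\exp\Big(-n\,\frac{0.98\,\delta_0^2}{12+13\,\delta_0}\Big(\frac{a}{\lVert\varphi\rVert}-0.254\,\delta_0\Big)\Big).\]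
   Context: $\Omega$ is a Polish metric space with its Borel $\sigma$-algebra; $\mathsf{M}=(m_x)_{x\in\Omega}$ is a transition kernel on $\Omega$ (each $m_x$ is a Borel probability measure); a Markov chain $(X_k)_{k\ge0}$ follows $\mathsf{M}$ if, conditionally on $X_k=x$, $X_{k+1}$ has law $m_x$. $\mathbb{P}_\mu$ denotes probability when $X_0\sim\mu$. We write $\nu(f)=\int f\,d\nu$. $\mathscr{X}$ is a Banach space of (Borel measurable) functions $\Omega\to\mathbb{R}$ (or $\Omega\to\mathbb{C}$) with norm $\lVert\cdot\rVert$ such that: (1) $\lVert f\rVert\ge\lVert f\rVert_\infty$ (uniform norm) for all $f\in\mathscr{X}$; (2) $\mathscr{X}$ is a Banach algebra: $\lVert fg\rVert\le\lVert f\rVert\lVert g\rVert$; (3) $\mathscr{X}$ contains the constant functions and $\lVert\mathbf{1}\rVert=1$, where $\mathbf{1}$ is the constant function $1$. The averaging operator is $L_0f(x)=\int_\Omega f(y)\,dm_x(y)$. It is assumed that $L_0$ is a bounded operator $\mathscr{X}\to\mathscr{X}$ of operator norm $\lVert L_0\rVert=1$, and that it is contracting with gap $\delta_0\in(0,1]$: there is a closed hyperplane $G_0\subset\mathscr{X}$ with $\lVert L_0f\rVert\le(1-\delta_0)\lVert f\rVert$ for all $f\in G_0$. $\mu_0$ denotes a stationary probability measure of $\mathsf{M}$ (so $\mu_0(L_0f)=\mu_0(f)$ for $f\in\mathscr{X}$), which exists and is unique as a linear form on $\mathscr{X}$, and $G_0=\{f\in\mathscr{X}:\mu_0(f)=0\}$.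 *)

theory Defs
  imports "HOL-Probability.Probability"
begin

text \<open>
  A Banach algebra of scalar functions on a space is given by its carrier \<open>X\<close>, a set of functions,
  and its norm \<open>nrm\<close>, which is meaningful on \<open>X\<close> only.  By the Gelfand--Mazur theorem the
  scalar type \<open>'k\<close> below can only be a copy of the reals or of the complex numbers, so the
  real and the complex case are treated at once.
\<close>

locale banach_function_algebra =
  fixes X :: "('a::topological_space \<Rightarrow> 'k::{real_normed_field, banach, second_countable_topology}) set"
    and nrm :: "('a \<Rightarrow> 'k) \<Rightarrow> real"
  assumes borel: "f \<in> X \<Longrightarrow> f \<in> borel_measurable borel"
    and add_closed: "f \<in> X \<Longrightarrow> g \<in> X \<Longrightarrow> (\<lambda>x. f x + g x) \<in> X"
    and scale_closed: "f \<in> X \<Longrightarrow> (\<lambda>x. c * f x) \<in> X"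
    and const_closed: "(\<lambda>x. c) \<in> X"
    and mult_closed: "f \<in> X \<Longrightarrow> g \<in> X \<Longrightarrow> (\<lambda>x. f x * g x) \<in> X"
    and nrm_triangle: "f \<in> X \<Longrightarrow> g \<in> X \<Longrightarrow> nrm (\<lambda>x. f x + g x) \<le> nrm f + nrm g"
    and nrm_scale: "f \<in> X \<Longrightarrow> nrm (\<lambda>x. c * f x) = norm c * nrm f"
    \<comment> \<open>domination of the uniform norm; it also makes \<open>nrm\<close> nonnegative and definite\<close>
    and norm_le_nrm: "f \<in> X \<Longrightarrow> norm (f x) \<le> nrm f"
    and nrm_mult: "f \<in> X \<Longrightarrow> g \<in> X \<Longrightarrow> nrm (\<lambda>x. f x * g x) \<le> nrm f * nrm g"
    and nrm_one: "nrm (\<lambda>x. 1) = 1"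
    and nrm_complete:
      "(\<And>i. F i \<in> X) \<Longrightarrow>
       (\<And>e. e > 0 \<Longrightarrow> \<exists>n0. \<forall>i\<ge>n0. \<forall>j\<ge>n0. nrm (\<lambda>x. F i x - F j x) < e) \<Longrightarrow>
       \<exists>f\<in>X. (\<lambda>i. nrm (\<lambda>x. F i x - f x)) \<longlonglongrightarrow> 0"

definition closed_hyperplane ::
    "('a \<Rightarrow> 'k::real_normed_field) set \<Rightarrow> (('a \<Rightarrow> 'k) \<Rightarrow> real) \<Rightarrow> ('a \<Rightarrow> 'k) set \<Rightarrow> bool" where
  "closed_hyperplane X nrm G \<longleftrightarrow>
     G \<subseteq> X \<and> (\<lambda>x. 0) \<in> G \<and>
     (\<forall>f\<in>G. \<forall>g\<in>G. (\<lambda>x. f x + g x) \<in> G) \<and>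
     (\<forall>f\<in>G. \<forall>c. (\<lambda>x. c * f x) \<in> G) \<and>
     (\<exists>h\<in>X - G. \<forall>f\<in>X. \<exists>g\<in>G. \<exists>c. f = (\<lambda>x. g x + c * h x)) \<and>
     (\<forall>F. \<forall>f\<in>X. (\<forall>i. F i \<in> G) \<longrightarrow> (\<lambda>i. nrm (\<lambda>x. F i x - f x)) \<longlonglongrightarrow> 0 \<longrightarrow> f \<in> G)"

text \<open>Linearity is not part of this predicate: it is applied to averaging operators, which are
  linear on bounded Borel functions.\<close>

definition bounded_operator ::
    "('a \<Rightarrow> 'k) set \<Rightarrow> (('a \<Rightarrow> 'k) \<Rightarrow> real) \<Rightarrow> (('a \<Rightarrow> 'k) \<Rightarrow> ('a \<Rightarrow> 'k)) \<Rightarrow> bool" where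
  "bounded_operator X nrm T \<longleftrightarrow> (\<forall>f\<in>X. T f \<in> X) \<and> (\<exists>C. \<forall>f\<in>X. nrm (T f) \<le> C * nrm f)"

text \<open>As for \<^const>\<open>onorm\<close>; it is to be used together with \<^const>\<open>bounded_operator\<close>.\<close>

definition operator_norm ::
    "('a \<Rightarrow> 'k) set \<Rightarrow> (('a \<Rightarrow> 'k) \<Rightarrow> real) \<Rightarrow> (('a \<Rightarrow> 'k) \<Rightarrow> ('a \<Rightarrow> 'k)) \<Rightarrow> real" where
  "operator_norm X nrm T = (SUP f\<in>X. nrm (T f) / nrm f)"

definition transition_kernel :: "('a::topological_space \<Rightarrow> 'a measure) \<Rightarrow> bool" where
  "transition_kernel M \<longleftrightarrow> M \<in> borel \<rightarrow>\<^sub>M prob_algebra borel"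

definition averaging ::
    "('a \<Rightarrow> 'a measure) \<Rightarrow> ('a \<Rightarrow> 'k::{banach, second_countable_topology}) \<Rightarrow> 'a \<Rightarrow> 'k" where
  "averaging M f = (\<lambda>x. \<integral>y. f y \<partial>M x)"

definition stationary_measure ::
    "('a::topological_space \<Rightarrow> 'a measure) \<Rightarrow> 'a measure \<Rightarrow> bool" where
  "stationary_measure M \<mu> \<longleftrightarrow> \<mu> \<in> space (prob_algebra borel) \<and> \<mu> \<bind> M = \<mu>"

definition past ::
    "'w measure \<Rightarrow> (nat \<Rightarrow> 'w \<Rightarrow> 'a::topological_space) \<Rightarrow> nat \<Rightarrow> 'w measure" where
  "past P X k = sigma (space P) {X i -` B \<inter> space P | i B. i \<le> k \<and> B \<in> sets borel}"

text \<open>The Markov property is with respect to the natural filtration of the process.\<close>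

definition markov_chain ::
    "'w measure \<Rightarrow> ('a::topological_space \<Rightarrow> 'a measure) \<Rightarrow> 'a measure \<Rightarrow> (nat \<Rightarrow> 'w \<Rightarrow> 'a) \<Rightarrow> bool" where
  "markov_chain P M \<mu> X \<longleftrightarrow>
     prob_space P \<and> (\<forall>k. X k \<in> P \<rightarrow>\<^sub>M borel) \<and> distr P borel (X 0) = \<mu> \<and>
     (\<forall>k. \<forall>B\<in>sets borel.
        AE w in P. real_cond_exp P (past P X k) (indicator (X (Suc k) -` B \<inter> space P)) w
                     = measure (M (X k w)) B)"

end

theory Submission
  imports Defs
begin

text \<open>
  Rescale the observable to \<open>\<theta> = t \<phi>\<close> with a small \<open>t > 0\<close>, and let the tilted operator be
  \<open>f \<mapsto> L (exp \<theta> \<cdot> f)\<close>, where \<open>L\<close> is the averaging operator.  By the Markov property the exponential moment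
  \<open>E exp (\<theta> (X 1) + \<dots> + \<theta> (X n))\<close> is the integral of the \<open>n\<close>-th tilted iterate of the constant
  \<open>1\<close> against the initial law (\<open>markov_chain_exp_sum\<close>), and a Chernoff bound turns an estimate of this
  iterate into a tail estimate.

  The iterates can be estimated without perturbation theory of the leading eigenvalue.  Consider the cone
  of functions \<open>f = \<alpha> + g\<close> whose stationary mean \<open>\<alpha>\<close> is positive and whose centered part satisfies
  \<open>N g \<le> \<kappa> \<alpha>\<close>.  Tilting enlarges the centered part by about \<open>2 N \<theta> \<alpha>\<close>, and the spectral gap then shrinks
  it by \<open>1 - \<delta>\<close>, so the cone is preserved as soon as \<open>\<kappa>\<close> is about \<open>2 N \<theta> / \<delta>\<close>.  Inside the cone one step
  multiplies the mean by at most
  \<open>exp (\<pi> \<theta> + (N \<theta>)\<^sup>2 / 2 + exp (N \<theta>) (exp (N \<theta>) - 1) \<kappa>)\<close>, where \<open>\<pi> \<theta>\<close> is the stationary mean: the first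
  two terms come from Hoeffding's lemma under the stationary measure, the last from the correlation between
  \<open>exp \<theta>\<close> and \<open>g\<close> (\<open>tilted_mean_cone\<close>).  This makes the centered log-moment grow by about
  \<open>2 (N \<theta>)\<^sup>2 / \<delta>\<close> per step, which is the order in \<open>\<delta>\<close> of the largest possible
  asymptotic variance.  Finally a function in
  the cone is bounded pointwise by \<open>(1 + \<kappa>) \<alpha>\<close>, which deals with every initial law at the price of a
  constant factor (\<open>exponential_moment_bound\<close>).

  It remains to choose \<open>t\<close>: by optimizing the quadratic exponent when \<open>a\<close> is small, and at the end of the
  admissible range otherwise (\<open>concentration\<close>).  The argument runs in the algebra of real-valued members (\<open>real_valued_subalgebra\<close>), whatever the scalars.
\<close>

section \<open>Exponentials and real-valued members of a Banach function algebra\<close>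

context banach_function_algebra
begin

lemma diff_closed: "f \<in> X \<Longrightarrow> g \<in> X \<Longrightarrow> (\<lambda>x. f x - g x) \<in> X"
  using add_closed[of f "\<lambda>x. (-1) * g x"] scale_closed[of g "-1"] by simp

lemma nrm_minus: "f \<in> X \<Longrightarrow> nrm (\<lambda>x. - f x) = nrm f"
  using nrm_scale[of f "-1"] by simp

lemma uminus_closed: "f \<in> X \<Longrightarrow> (\<lambda>x. - f x) \<in> X"
  using scale_closed[of f "-1"] by simp

lemma nrm_diff: "f \<in> X \<Longrightarrow> g \<in> X \<Longrightarrow> nrm (\<lambda>x. f x - g x) \<le> nrm f + nrm g"
  using nrm_triangle[of f "\<lambda>x. - g x"] nrm_minus[of g] uminus_closed[of g] by simp

lemma nrm_const: "nrm (\<lambda>x. c) = norm c"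
  using nrm_scale[OF const_closed[of 1], of c] nrm_one by simp

lemma nrm_nonneg: "f \<in> X \<Longrightarrow> 0 \<le> nrm f"
  using norm_le_nrm[of f undefined] norm_ge_zero order_trans by blast

lemma integrable_member:
  "f \<in> X \<Longrightarrow> prob_space \<nu> \<Longrightarrow> sets \<nu> = sets borel \<Longrightarrow> integrable \<nu> f"
  using norm_le_nrm borel measurable_cong_sets[of \<nu> borel borel borel]
  by (intro finite_measure.integrable_const_bound[of _ _ "nrm f"] prob_space.finite_measure)
    (auto intro!: AE_I2)

lemma power_closed: "f \<in> X \<Longrightarrow> (\<lambda>x. f x ^ k) \<in> X"
  by (induction k) (auto intro: const_closed mult_closed)

lemma nrm_power_le: "f \<in> X \<Longrightarrow> nrm (\<lambda>x. f x ^ k) \<le> nrm f ^ k"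
proof (induction k)
  case 0
  show ?case using nrm_one by simp
next
  case (Suc k)
  have "nrm (\<lambda>x. f x * f x ^ k) \<le> nrm f * nrm (\<lambda>x. f x ^ k)"
    using Suc.prems by (intro nrm_mult power_closed)
  also have "\<dots> \<le> nrm f * nrm f ^ k"
    using Suc by (intro mult_left_mono nrm_nonneg) auto
  finally show ?case by simp
qed

lemma sum_closed: "finite K \<Longrightarrow> (\<And>k. k \<in> K \<Longrightarrow> F k \<in> X) \<Longrightarrow> (\<lambda>x. \<Sum>k\<in>K. F k x) \<in> X"
  by (induction K rule: finite_induct) (auto intro: const_closed add_closed)

lemma nrm_sum_le:
  "finite K \<Longrightarrow> (\<And>k. k \<in> K \<Longrightarrow> F k \<in> X) \<Longrightarrow> nrm (\<lambda>x. \<Sum>k\<in>K. F k x) \<le> (\<Sum>k\<in>K. nrm (F k))"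
proof (induction K rule: finite_induct)
  case empty
  show ?case using nrm_const[of 0] by simp
next
  case (insert k K)
  have "nrm (\<lambda>x. F k x + (\<Sum>k\<in>K. F k x)) \<le> nrm (F k) + nrm (\<lambda>x. \<Sum>k\<in>K. F k x)"
    using insert by (intro nrm_triangle sum_closed) auto
  with insert show ?case by fastforce
qed

text \<open>The partial sums of the exponential series are Cauchy for \<open>nrm\<close> by submultiplicativity; since
  \<open>nrm\<close> dominates the uniform norm, their limit in the algebra is the pointwise exponential.  Bounding
  the series without its constant term by the norms of its terms gives the second claim.\<close>

lemma
  assumes f: "f \<in> X"
  shows exp_closed: "(\<lambda>x. exp (f x)) \<in> X"
    and nrm_exp_minus_one_le: "nrm (\<lambda>x. exp (f x) - 1) \<le> exp (nrm f) - 1"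
proof -
  define T where "T k = (\<lambda>x. f x ^ k /\<^sub>R fact k)" for k
  define F where "F i = (\<lambda>x. \<Sum>k<i. T k x)" for i
  define a where "a k = nrm f ^ k /\<^sub>R fact k" for k
  have T_eq: "T k = (\<lambda>x. of_real (inverse (fact k)) * f x ^ k)" for k
    by (simp add: T_def scaleR_conv_of_real)
  have T: "T k \<in> X" for k
    unfolding T_eq by (intro scale_closed power_closed f)
  have nT: "nrm (T k) \<le> a k" for k
  proof -
    have "nrm (T k) = norm (of_real (inverse (fact k)) :: 'k) * nrm (\<lambda>x. f x ^ k)"
      unfolding T_eq by (intro nrm_scale power_closed f)
    also have "\<dots> \<le> inverse (fact k) * nrm f ^ k"
      unfolding norm_of_real using nrm_power_le[OF f, of k] nrm_nonneg[OF power_closed[OF f]]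
      by (intro mult_mono) auto
    finally show ?thesis by (simp add: a_def)
  qed
  have F: "F i \<in> X" for i
    unfolding F_def by (intro sum_closed T) auto
  have a_sums: "a sums exp (nrm f)"
    unfolding a_def by (rule exp_converges)
  then have a_summable: "summable a" by (rule sums_summable)
  have tail: "nrm (\<lambda>x. F i x - F j x) \<le> sum a {j..<i}" if "j \<le> i" for i j
  proof -
    have "{..<i} = {..<j} \<union> {j..<i}" using that by auto
    then have "F i x - F j x = (\<Sum>k=j..<i. T k x)" for x
      unfolding F_def by (simp add: sum.union_disjoint ivl_disj_int)
    then have "nrm (\<lambda>x. F i x - F j x) \<le> (\<Sum>k=j..<i. nrm (T k))"
      using nrm_sum_le[of "{j..<i}" T] T by simp
    also have "\<dots> \<le> sum a {j..<i}" by (intro sum_mono nT)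
    finally show ?thesis .
  qed
  have sym: "nrm (\<lambda>x. F i x - F j x) = nrm (\<lambda>x. F j x - F i x)" for i j
    using nrm_minus[OF diff_closed[OF F F], of i j] by simp
  have "\<exists>n0. \<forall>i\<ge>n0. \<forall>j\<ge>n0. nrm (\<lambda>x. F i x - F j x) < e" if e: "e > 0" for e
  proof -
    obtain n0 where n0: "\<And>m n. m \<ge> n0 \<Longrightarrow> norm (sum a {m..<n}) < e"
      using a_summable e unfolding summable_Cauchy by blast
    have le: "nrm (\<lambda>x. F i x - F j x) < e" if "j \<le> i" "n0 \<le> j" for i j
      using tail[OF that(1)] n0[OF that(2), of i] by simp
    have "nrm (\<lambda>x. F i x - F j x) < e" if "n0 \<le> i" "n0 \<le> j" for i j
      using le[of i j] le[of j i] sym[of i j] that by (cases "i \<le> j") auto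
    then show ?thesis by blast
  qed
  with F obtain g where g: "g \<in> X" and lim: "(\<lambda>i. nrm (\<lambda>x. F i x - g x)) \<longlonglongrightarrow> 0"
    using nrm_complete[of F] by blast
  have g_eq: "g x = exp (f x)" for x
  proof (rule LIMSEQ_unique)
    have "norm (F i x - g x) \<le> nrm (\<lambda>x. F i x - g x)" for i
      by (rule norm_le_nrm[OF diff_closed[OF F g]])
    then have "(\<lambda>i. F i x - g x) \<longlonglongrightarrow> 0"
      by (intro Lim_null_comparison[OF _ lim] always_eventually allI)
    then show "(\<lambda>i. F i x) \<longlonglongrightarrow> g x" by (simp add: LIM_zero_iff)
    show "(\<lambda>i. F i x) \<longlonglongrightarrow> exp (f x)"
      using exp_converges[of "f x"] by (simp add: F_def T_def sums_def)
  qed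
  have "nrm (\<lambda>x. g x - 1) \<le> exp (nrm f) - 1"
  proof (rule tendsto_lowerbound)
    show "(\<lambda>i. nrm (\<lambda>x. F i x - g x) + (sum a {..<i} - 1)) \<longlonglongrightarrow> exp (nrm f) - 1"
      using tendsto_add[OF lim tendsto_diff[OF a_sums[unfolded sums_def] tendsto_const]] by simp
    have "nrm (\<lambda>x. g x - 1) \<le> nrm (\<lambda>x. F i x - g x) + (sum a {..<i} - 1)" if "1 \<le> i" for i
    proof -
      have F1: "F (Suc 0) = (\<lambda>x. 1)" by (simp add: F_def T_def)
      have "{..<i} = {..<1} \<union> {1..<i}" using that by auto
      then have a1: "sum a {..<i} - 1 = sum a {1..<i}"
        by (simp add: sum.union_disjoint ivl_disj_int a_def)
      have "nrm (\<lambda>x. (F i x - 1) - (F i x - g x)) \<le> nrm (\<lambda>x. F i x - 1) + nrm (\<lambda>x. F i x - g x)"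
        by (intro nrm_diff diff_closed F g const_closed)
      with tail[OF that] show ?thesis by (simp add: F1 a1)
    qed
    then show "\<forall>\<^sub>F i in sequentially. nrm (\<lambda>x. g x - 1)
        \<le> nrm (\<lambda>x. F i x - g x) + (sum a {..<i} - 1)"
      using eventually_sequentially by blast
  qed simp
  moreover have "g = (\<lambda>x. exp (f x))" using g_eq by (rule ext)
  ultimately show "(\<lambda>x. exp (f x)) \<in> X" "nrm (\<lambda>x. exp (f x) - 1) \<le> exp (nrm f) - 1"
    using g by simp_all
qed

text \<open>All functions that occur in the concentration argument are real-valued, so the scalar field is
  eliminated here once and for all.\<close>

lemma real_valued_subalgebra:
  "banach_function_algebra {f :: 'a \<Rightarrow> real. (\<lambda>x. of_real (f x)) \<in> X} (\<lambda>f. nrm (\<lambda>x. of_real (f x)))"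
proof
  fix F :: "nat \<Rightarrow> 'a \<Rightarrow> real"
  assume "\<And>i. F i \<in> {f. (\<lambda>x. of_real (f x)) \<in> X}"
  then have F: "(\<lambda>x. of_real (F i x)) \<in> X" for i by simp
  assume C: "\<And>e. e > 0 \<Longrightarrow> \<exists>n0. \<forall>i\<ge>n0. \<forall>j\<ge>n0. nrm (\<lambda>x. of_real (F i x - F j x)) < e"
  from nrm_complete[of "\<lambda>i x. of_real (F i x)", OF F] C
  obtain f where f: "f \<in> X" and lim: "(\<lambda>i. nrm (\<lambda>x. of_real (F i x) - f x)) \<longlonglongrightarrow> 0"
    by (auto simp: of_real_diff)
  have conv: "(\<lambda>i. of_real (F i x) :: 'k) \<longlonglongrightarrow> f x" for x
  proof -
    have "norm (of_real (F i x) - f x) \<le> nrm (\<lambda>x. of_real (F i x) - f x)" for i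
      by (rule norm_le_nrm[OF diff_closed[OF F f]])
    then have "(\<lambda>i. of_real (F i x) - f x) \<longlonglongrightarrow> 0"
      by (intro Lim_null_comparison[OF _ lim] always_eventually allI)
    then show ?thesis by (simp add: LIM_zero_iff)
  qed
  have "\<exists>c. f x = of_real c" for x
  proof -
    have "Cauchy (\<lambda>i. of_real (F i x) :: 'k)"
      using conv LIMSEQ_imp_Cauchy by blast
    then have "Cauchy (\<lambda>i. F i x)"
      by (simp add: Cauchy_def dist_norm flip: of_real_diff)
    then obtain c where "(\<lambda>i. F i x) \<longlonglongrightarrow> c"
      using Cauchy_convergent convergent_def by blast
    then have "(\<lambda>i. of_real (F i x) :: 'k) \<longlonglongrightarrow> of_real c"
      by (rule tendsto_of_real)
    with conv LIMSEQ_unique show ?thesis by blast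
  qed
  then obtain c where c: "f = (\<lambda>x. of_real (c x))" by metis
  show "\<exists>f\<in>{f. (\<lambda>x. of_real (f x)) \<in> X}. (\<lambda>i. nrm (\<lambda>x. of_real (F i x - f x))) \<longlonglongrightarrow> 0"
    using f lim unfolding c by (auto simp: of_real_diff)
next
  fix f :: "'a \<Rightarrow> real"
  assume "f \<in> {f. (\<lambda>x. of_real (f x)) \<in> X}"
  then have f: "(\<lambda>x. of_real (f x)) \<in> X" by simp
  define K where "K = nrm (\<lambda>x. of_real (f x))"
  have [measurable]: "(\<lambda>x. of_real (f x) :: 'k) \<in> borel_measurable borel"
    by (rule borel[OF f])
  \<comment> \<open>A nonnegative real is recovered from its image in \<open>'k\<close> as a norm, which makes it measurable;
    the shift by \<open>K\<close> makes the function nonnegative.\<close>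
  have "\<bar>f x\<bar> \<le> K" for x
    using norm_le_nrm[OF f, of x] by (simp add: K_def)
  then have "0 \<le> f x + K" for x
    by (smt (verit))
  then have "f = (\<lambda>x. norm (of_real (f x) + of_real K :: 'k) - K)"
    by (simp flip: of_real_add)
  moreover have "(\<lambda>x. norm (of_real (f x) + of_real K :: 'k) - K) \<in> borel_measurable borel"
    by measurable
  ultimately show "f \<in> borel_measurable borel" by metis
qed (auto simp: of_real_diff nrm_const nrm_scale nrm_one nrm_mult
    intro: add_closed scale_closed const_closed mult_closed nrm_triangle order.trans[OF _ norm_le_nrm])

end

section \<open>Averaging operators with a spectral gap\<close>

text \<open>Uncentered form of Hoeffding's lemma for the range \<open>[-s, s]\<close>; its length is \<open>2 s\<close>, whence
  \<open>s\<^sup>2 / 2 = (2 s)\<^sup>2 / 8\<close>.\<close>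

lemma prob_space_Hoeffding_exp_bound:
  fixes f :: "'a \<Rightarrow> real"
  assumes "prob_space \<nu>" and f [measurable]: "f \<in> borel_measurable \<nu>" and bd: "\<And>x. \<bar>f x\<bar> \<le> s"
  shows "(\<integral>x. exp (f x) \<partial>\<nu>) \<le> exp ((\<integral>x. f x \<partial>\<nu>) + s\<^sup>2 / 2)"
proof -
  interpret prob_space \<nu> by fact
  define m where "m = (\<integral>x. f x \<partial>\<nu>)"
  interpret interval_bounded_random_variable \<nu> f "-s" s
    by unfold_locales (use bd in \<open>auto simp: abs_le_iff minus_le_iff\<close>)
  have "(\<integral>\<^sup>+x. ennreal (exp (f x - m)) \<partial>\<nu>) \<le> ennreal (exp (s\<^sup>2 / 2))"
    using Hoeffdings_lemma_nn_integral[of 1] by (simp add: m_def power2_eq_square)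
  moreover have "integrable \<nu> (\<lambda>x. exp (f x - m))"
  proof (rule integrable_const_bound)
    show "AE x in \<nu>. norm (exp (f x - m)) \<le> exp (s - m)"
      using bd by (auto simp: abs_le_iff)
  qed measurable
  ultimately have "(\<integral>x. exp (f x - m) \<partial>\<nu>) \<le> exp (s\<^sup>2 / 2)"
    by (simp add: nn_integral_eq_integral)
  then show ?thesis
    by (simp add: exp_diff exp_add m_def pos_divide_le_eq mult.commute)
qed

lemma transition_kernel_prob_space: "transition_kernel M \<Longrightarrow> prob_space (M x)"
  and transition_kernel_sets: "transition_kernel M \<Longrightarrow> sets (M x) = sets borel"
  unfolding transition_kernel_def
  using measurable_space[of M borel "prob_algebra borel" x] by (auto simp: space_prob_algebra)

text \<open>The contracted hyperplane appears as the kernel of the stationary measure, so that subtracting the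
  stationary mean projects onto it.\<close>

locale real_spectral_gap = banach_function_algebra A N
  for A :: "('a::topological_space \<Rightarrow> real) set" and N :: "('a \<Rightarrow> real) \<Rightarrow> real" +
  fixes M :: "'a \<Rightarrow> 'a measure" and \<pi> :: "'a measure" and \<delta> :: real
  assumes kernel: "transition_kernel M"
    and averaging_closed: "f \<in> A \<Longrightarrow> averaging M f \<in> A"
    and stationary: "stationary_measure M \<pi>"
    and gap: "f \<in> A \<Longrightarrow> (\<integral>x. f x \<partial>\<pi>) = 0 \<Longrightarrow> N (averaging M f) \<le> (1 - \<delta>) * N f"
    and gap_pos: "0 < \<delta>" and gap_le_1: "\<delta> \<le> 1"
begin

lemma prob_space_stationary: "prob_space \<pi>"
  and sets_stationary: "sets \<pi> = sets borel"
  using stationary by (auto simp: stationary_measure_def space_prob_algebra)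

lemmas integrable_stationary = integrable_member[OF _ prob_space_stationary sets_stationary]
lemmas integrable_kernel =
  integrable_member[OF _ transition_kernel_prob_space[OF kernel] transition_kernel_sets[OF kernel]]

lemma measure_stationary: "measure \<pi> (space \<pi>) = 1"
  using prob_space.prob_space[OF prob_space_stationary] .

lemma abs_integral_stationary_le: "f \<in> A \<Longrightarrow> \<bar>\<integral>x. f x \<partial>\<pi>\<bar> \<le> N f"
proof -
  assume f: "f \<in> A"
  interpret prob_space \<pi> by (rule prob_space_stationary)
  have "\<bar>\<integral>x. f x \<partial>\<pi>\<bar> \<le> (\<integral>x. \<bar>f x\<bar> \<partial>\<pi>)" by (rule integral_abs_bound)
  also have "\<dots> \<le> N f"
    using norm_le_nrm[OF f] integrable_stationary[OF f] by (intro integral_le_const) auto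
  finally show ?thesis .
qed

lemma averaging_const: "averaging M (\<lambda>x. c) = (\<lambda>x. c :: real)"
  using prob_space.prob_space[OF transition_kernel_prob_space[OF kernel]]
  by (simp add: averaging_def)

lemma averaging_add:
  "f \<in> A \<Longrightarrow> g \<in> A \<Longrightarrow> averaging M (\<lambda>x. f x + g x) = (\<lambda>x. averaging M f x + averaging M g x)"
  by (simp add: averaging_def integrable_kernel)

lemma kernel_subprob: "M \<in> borel \<rightarrow>\<^sub>M subprob_algebra borel"
  using kernel unfolding transition_kernel_def by (rule measurable_prob_algebraD)

lemma nn_integral_kernel:
  "f \<in> A \<Longrightarrow> (\<And>x. 0 \<le> f x) \<Longrightarrow> (\<integral>\<^sup>+y. ennreal (f y) \<partial>M x) = ennreal (averaging M f x)"
  unfolding averaging_def by (intro nn_integral_eq_integral integrable_kernel) auto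

lemma averaging_nonneg: "(\<And>x. 0 \<le> f x) \<Longrightarrow> 0 \<le> averaging M f (x::'a)" for f :: "'a \<Rightarrow> real"
  unfolding averaging_def by (rule integral_nonneg_AE) auto

lemma integral_averaging:
  assumes f: "f \<in> A"
  shows "(\<integral>x. averaging M f x \<partial>\<pi>) = (\<integral>x. f x \<partial>\<pi>)"
proof -
  have nonneg: "(\<integral>x. averaging M g x \<partial>\<pi>) = (\<integral>x. g x \<partial>\<pi>)" if g: "g \<in> A" and pos: "\<And>x. 0 \<le> g x" for g
  proof -
    have "ennreal (\<integral>x. g x \<partial>\<pi>) = (\<integral>\<^sup>+x. ennreal (g x) \<partial>(\<pi> \<bind> M))"
      using stationary pos integrable_stationary[OF g]
      by (simp add: stationary_measure_def nn_integral_eq_integral)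
    also have "\<dots> = (\<integral>\<^sup>+x. \<integral>\<^sup>+y. ennreal (g y) \<partial>M x \<partial>\<pi>)"
    proof (rule nn_integral_bind)
      show "(\<lambda>x. ennreal (g x)) \<in> borel_measurable borel" using borel[OF g] by measurable
      show "M \<in> \<pi> \<rightarrow>\<^sub>M subprob_algebra borel"
        using kernel_subprob measurable_cong_sets[OF sets_stationary refl] by blast
    qed
    also have "\<dots> = (\<integral>\<^sup>+x. ennreal (averaging M g x) \<partial>\<pi>)"
      by (simp add: nn_integral_kernel[OF g pos])
    also have "\<dots> = ennreal (\<integral>x. averaging M g x \<partial>\<pi>)"
      using integrable_stationary[OF averaging_closed[OF g]] averaging_nonneg[OF pos]
      by (intro nn_integral_eq_integral) auto
    finally show ?thesis
      using pos averaging_nonneg[of g, OF pos] by (simp add: integral_nonneg)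
  qed
  \<comment> \<open>Adding the constant \<open>N f\<close> makes \<open>f\<close> nonnegative and changes both sides equally.\<close>
  define g where "g = (\<lambda>x. f x + N f)"
  have "0 \<le> g x" for x
    using norm_le_nrm[OF f, of x] by (simp add: g_def)
  then have "(\<integral>x. averaging M g x \<partial>\<pi>) = (\<integral>x. g x \<partial>\<pi>)"
    unfolding g_def by (intro nonneg add_closed const_closed f) auto
  then show ?thesis
    unfolding g_def averaging_add[OF f const_closed] averaging_const
    using integrable_stationary[OF f] integrable_stationary[OF averaging_closed[OF f]]
      integrable_stationary[OF const_closed]
    by (simp add: measure_stationary)
qed

section \<open>Tilted averaging on a cone around the constants\<close>

definition tilted :: "('a \<Rightarrow> real) \<Rightarrow> ('a \<Rightarrow> real) \<Rightarrow> 'a \<Rightarrow> real" where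
  "tilted \<theta> f = averaging M (\<lambda>y. exp (\<theta> y) * f y)"

text \<open>The positive multiples of the functions at distance at most \<open>\<kappa>\<close> from the constant \<open>1\<close>, among those
  of mean 1.\<close>

definition mean_cone :: "real \<Rightarrow> ('a \<Rightarrow> real) set" where
  "mean_cone \<kappa> = {f \<in> A. 0 < (\<integral>x. f x \<partial>\<pi>) \<and> N (\<lambda>x. f x - (\<integral>x. f x \<partial>\<pi>)) \<le> \<kappa> * (\<integral>x. f x \<partial>\<pi>)}"

lemma tilted_closed: "\<theta> \<in> A \<Longrightarrow> f \<in> A \<Longrightarrow> tilted \<theta> f \<in> A"
  unfolding tilted_def by (intro averaging_closed mult_closed exp_closed)

text \<open>Write \<open>f = \<alpha> + g\<close> with \<open>\<alpha>\<close> the mean of \<open>f\<close>, and \<open>E = exp \<theta> - 1\<close>.  Then \<open>exp \<theta> \<cdot> f = \<alpha> + g + E f\<close>, and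
  averaging shrinks the centered part of this by the factor \<open>1 - \<delta>\<close>.  So the oscillation grows at
  most from \<open>\<kappa> \<alpha>\<close> to \<open>(1 - \<delta>) (\<kappa> + 2 e (1 + \<kappa>)) \<alpha>\<close>, while the mean drops at most to
  \<open>(1 - e (1 + \<kappa>)) \<alpha>\<close>: the hypothesis \<open>stable\<close> says that the ratio of these stays below \<open>\<kappa>\<close>.

  For the growth of the mean, the constant part of \<open>f\<close> contributes the Laplace transform of \<open>\<theta>\<close>
  under the stationary measure, which Hoeffding's lemma controls, and \<open>g\<close> contributes the mean of \<open>E g\<close>.
  With \<open>\<kappa>\<close> of order \<open>N \<theta> / \<delta>\<close> both contributions are quadratic in \<open>\<theta>\<close>, the second with a factor
  \<open>1 / \<delta>\<close>.\<close>

lemma tilted_mean_cone: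
  assumes \<theta>: "\<theta> \<in> A" and f: "f \<in> mean_cone \<kappa>" and \<kappa>: "0 \<le> \<kappa>"
  defines "e \<equiv> exp (N \<theta>) - 1"
  assumes small: "e * (1 + \<kappa>) < 1"
    and stable: "(1 - \<delta>) * (\<kappa> + 2 * e * (1 + \<kappa>)) \<le> \<kappa> * (1 - e * (1 + \<kappa>))"
  shows "tilted \<theta> f \<in> mean_cone \<kappa>"
    and "(\<integral>x. tilted \<theta> f x \<partial>\<pi>)
      \<le> exp ((\<integral>x. \<theta> x \<partial>\<pi>) + (N \<theta>)\<^sup>2 / 2 + exp (N \<theta>) * e * \<kappa>) * (\<integral>x. f x \<partial>\<pi>)"
proof -
  define \<alpha> where "\<alpha> = (\<integral>x. f x \<partial>\<pi>)"
  define g where "g = (\<lambda>x. f x - \<alpha>)"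
  define E where "E = (\<lambda>x. exp (\<theta> x) - 1)"
  define h where "h = (\<lambda>x. E x * f x)"
  define \<beta> where "\<beta> = (\<integral>x. h x \<partial>\<pi>)"
  have fA: "f \<in> A" and \<alpha>: "0 < \<alpha>" and Ng: "N g \<le> \<kappa> * \<alpha>"
    using f by (auto simp: mean_cone_def \<alpha>_def g_def)
  have gA: "g \<in> A" unfolding g_def by (intro diff_closed const_closed fA)
  have EA: "E \<in> A" unfolding E_def by (intro diff_closed const_closed exp_closed \<theta>)
  have hA: "h \<in> A" unfolding h_def by (intro mult_closed EA fA)
  have NE: "N E \<le> e" unfolding E_def e_def by (rule nrm_exp_minus_one_le[OF \<theta>])
  have e: "0 \<le> e" using nrm_nonneg[OF EA] NE by simp
  have "N f \<le> (1 + \<kappa>) * \<alpha>"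
    using nrm_triangle[OF gA const_closed[of \<alpha>]] nrm_const[of \<alpha>] Ng \<alpha>
    by (simp add: g_def algebra_simps)
  then have "N E * N f \<le> e * ((1 + \<kappa>) * \<alpha>)"
    using NE e nrm_nonneg[OF fA] by (intro mult_mono) auto
  then have Nh: "N h \<le> e * (1 + \<kappa>) * \<alpha>"
    using nrm_mult[OF EA fA] by (simp add: h_def mult.assoc)
  have \<beta>: "\<bar>\<beta>\<bar> \<le> e * (1 + \<kappa>) * \<alpha>"
    using abs_integral_stationary_le[OF hA] Nh by (simp add: \<beta>_def)
  define v where "v = (\<lambda>x. g x + (h x - \<beta>))"
  have vA: "v \<in> A" unfolding v_def by (intro add_closed diff_closed const_closed gA hA)
  note int = integrable_stationary[OF fA] integrable_stationary[OF hA]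
    integrable_stationary[OF gA] integrable_stationary[OF const_closed]
  have v0: "(\<integral>x. v x \<partial>\<pi>) = 0"
    unfolding v_def g_def using int by (simp add: measure_stationary \<alpha>_def \<beta>_def)
  have "N v \<le> N g + (N h + norm \<beta>)"
    unfolding v_def using nrm_triangle[OF gA diff_closed[OF hA const_closed[of \<beta>]]]
      nrm_diff[OF hA const_closed[of \<beta>]] nrm_const[of \<beta>] by simp
  also have "\<dots> \<le> (\<kappa> + 2 * e * (1 + \<kappa>)) * \<alpha>"
    using Ng Nh \<beta> by (simp add: algebra_simps)
  finally have Nv: "N v \<le> (\<kappa> + 2 * e * (1 + \<kappa>)) * \<alpha>" .
  have tilted_eq: "tilted \<theta> f = (\<lambda>x. averaging M v x + (\<alpha> + \<beta>))"
  proof -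
    have "(\<lambda>y. exp (\<theta> y) * f y) = (\<lambda>y. v y + (\<alpha> + \<beta>))"
      by (simp add: v_def h_def E_def g_def algebra_simps)
    then show ?thesis
      unfolding tilted_def using averaging_add[OF vA const_closed] by (simp add: averaging_const)
  qed
  have \<alpha>': "(\<integral>x. tilted \<theta> f x \<partial>\<pi>) = \<alpha> + \<beta>"
    unfolding tilted_eq
    using integrable_stationary[OF averaging_closed[OF vA]] int integral_averaging[OF vA] v0
    by (simp add: measure_stationary)
  have low: "(1 - e * (1 + \<kappa>)) * \<alpha> \<le> \<alpha> + \<beta>"
    using \<beta> by (simp add: algebra_simps)
  have "N (averaging M v) \<le> (1 - \<delta>) * N v" by (rule gap[OF vA v0])
  also have "\<dots> \<le> (1 - \<delta>) * ((\<kappa> + 2 * e * (1 + \<kappa>)) * \<alpha>)"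
    using gap_le_1 Nv by (intro mult_left_mono) auto
  also have "\<dots> \<le> \<kappa> * (1 - e * (1 + \<kappa>)) * \<alpha>"
    using mult_right_mono[OF stable, of \<alpha>] \<alpha> by (simp add: mult.assoc)
  also have "\<dots> \<le> \<kappa> * (\<alpha> + \<beta>)"
    using mult_left_mono[OF low \<kappa>] by (simp add: mult.assoc)
  finally have "N (averaging M v) \<le> \<kappa> * (\<alpha> + \<beta>)" .
  moreover have "0 < \<alpha> + \<beta>"
    using low mult_pos_pos[of "1 - e * (1 + \<kappa>)" \<alpha>] small \<alpha> by linarith
  ultimately show "tilted \<theta> f \<in> mean_cone \<kappa>"
    unfolding mean_cone_def using tilted_closed[OF \<theta> fA] by (simp add: \<alpha>') (simp add: tilted_eq)
  show "(\<integral>x. tilted \<theta> f x \<partial>\<pi>)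
      \<le> exp ((\<integral>x. \<theta> x \<partial>\<pi>) + (N \<theta>)\<^sup>2 / 2 + exp (N \<theta>) * e * \<kappa>) * (\<integral>x. f x \<partial>\<pi>)"
  proof -
    define m where "m = (\<integral>x. \<theta> x \<partial>\<pi>)"
    have m: "-m \<le> N \<theta>" using abs_integral_stationary_le[OF \<theta>] by (simp add: m_def)
    have EgA: "(\<lambda>x. E x * g x) \<in> A" by (intro mult_closed EA gA)
    have "h = (\<lambda>x. \<alpha> * (exp (\<theta> x)) + (E x * g x - \<alpha>))"
      by (simp add: h_def E_def g_def algebra_simps)
    then have "\<alpha> + \<beta> = \<alpha> * (\<integral>x. exp (\<theta> x) \<partial>\<pi>) + (\<integral>x. E x * g x \<partial>\<pi>)"
      using integrable_stationary[OF exp_closed[OF \<theta>]] integrable_stationary[OF EgA] int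
      by (simp add: \<beta>_def measure_stationary)
    also have "(\<integral>x. exp (\<theta> x) \<partial>\<pi>) \<le> exp (m + (N \<theta>)\<^sup>2 / 2)"
      unfolding m_def
      using norm_le_nrm[OF \<theta>] borel[OF \<theta>] measurable_cong_sets[OF sets_stationary refl]
      by (intro prob_space_Hoeffding_exp_bound prob_space_stationary) auto
    also have "(\<integral>x. E x * g x \<partial>\<pi>) \<le> e * (\<kappa> * \<alpha>)"
    proof -
      have "N E * N g \<le> e * (\<kappa> * \<alpha>)"
        using NE Ng e nrm_nonneg[OF gA] by (intro mult_mono) auto
      then show ?thesis
        using abs_integral_stationary_le[OF EgA] nrm_mult[OF EA gA] by linarith
    qed
    also have "\<alpha> * exp (m + (N \<theta>)\<^sup>2 / 2) + e * (\<kappa> * \<alpha>)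
        \<le> exp (m + (N \<theta>)\<^sup>2 / 2 + exp (N \<theta>) * e * \<kappa>) * \<alpha>"
    proof -
      define w where "w = exp (N \<theta>) * e * \<kappa>"
      have w: "0 \<le> w" using e \<kappa> by (simp add: w_def)
      \<comment> \<open>The factor \<open>exp (N \<theta>)\<close> compensates \<open>exp m\<close>, which may be as small as \<open>exp (- N \<theta>)\<close>.\<close>
      have "0 \<le> m + (N \<theta>)\<^sup>2 / 2 + N \<theta>"
        using m zero_le_power2[of "N \<theta>"] by linarith
      then have "1 \<le> exp (m + (N \<theta>)\<^sup>2 / 2) * exp (N \<theta>)"
        by (simp flip: exp_add)
      then have "e * \<kappa> * 1 \<le> e * \<kappa> * (exp (m + (N \<theta>)\<^sup>2 / 2) * exp (N \<theta>))"
        using e \<kappa> by (intro mult_left_mono) auto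
      also have "\<dots> = exp (m + (N \<theta>)\<^sup>2 / 2) * w" by (simp add: w_def)
      finally have "exp (m + (N \<theta>)\<^sup>2 / 2) + e * \<kappa> \<le> exp (m + (N \<theta>)\<^sup>2 / 2) * (1 + w)"
        by (simp add: algebra_simps)
      also have "\<dots> \<le> exp (m + (N \<theta>)\<^sup>2 / 2) * exp w"
        using exp_ge_add_one_self[of w] by (intro mult_left_mono) auto
      also have "\<dots> = exp (m + (N \<theta>)\<^sup>2 / 2 + w)" by (simp add: exp_add)
      finally show ?thesis
        using mult_right_mono[of _ _ \<alpha>] \<alpha> unfolding w_def[symmetric] by (fastforce simp: algebra_simps)
    qed
    finally show ?thesis
      using \<alpha> unfolding \<alpha>' by (simp add: \<alpha>_def m_def)
  qed
qed

lemma funpow_tilted_mean_cone: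
  assumes \<theta>: "\<theta> \<in> A" and \<kappa>: "0 \<le> \<kappa>"
  defines "e \<equiv> exp (N \<theta>) - 1"
  assumes small: "e * (1 + \<kappa>) < 1"
    and stable: "(1 - \<delta>) * (\<kappa> + 2 * e * (1 + \<kappa>)) \<le> \<kappa> * (1 - e * (1 + \<kappa>))"
  shows "(tilted \<theta> ^^ n) (\<lambda>x. 1) \<in> mean_cone \<kappa> \<and> (\<integral>x. (tilted \<theta> ^^ n) (\<lambda>x. 1) x \<partial>\<pi>)
      \<le> exp (n * ((\<integral>x. \<theta> x \<partial>\<pi>) + (N \<theta>)\<^sup>2 / 2 + exp (N \<theta>) * e * \<kappa>))"
proof (induction n)
  case 0
  show ?case
    using const_closed[of 1] nrm_const[of 0] \<kappa> by (simp add: mean_cone_def measure_stationary)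
next
  case (Suc n)
  note step = tilted_mean_cone[OF \<theta> conjunct1[OF Suc.IH] \<kappa> small[unfolded e_def] stable[unfolded e_def]]
  let ?r = "(\<integral>x. \<theta> x \<partial>\<pi>) + (N \<theta>)\<^sup>2 / 2 + exp (N \<theta>) * e * \<kappa>"
  have "(\<integral>x. (tilted \<theta> ^^ Suc n) (\<lambda>x. 1) x \<partial>\<pi>) \<le> exp ?r * (\<integral>x. (tilted \<theta> ^^ n) (\<lambda>x. 1) x \<partial>\<pi>)"
    using step(2) by (simp add: e_def)
  also have "\<dots> \<le> exp ?r * exp (n * ?r)"
    using Suc.IH by (intro mult_left_mono) auto
  also have "\<dots> = exp (Suc n * ?r)"
    by (simp add: algebra_simps flip: exp_add)
  finally show ?case using step(1) by simp
qed

lemma mean_cone_le: "f \<in> mean_cone \<kappa> \<Longrightarrow> f x \<le> (1 + \<kappa>) * (\<integral>x. f x \<partial>\<pi>)"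
  using norm_le_nrm[OF diff_closed[OF _ const_closed[of "\<integral>x. f x \<partial>\<pi>"]], of f x]
  by (auto simp: mean_cone_def algebra_simps)

end

section \<open>The Markov property for nonnegative integrands\<close>

lemma past_subalgebra:
  assumes X: "\<And>k. X k \<in> P \<rightarrow>\<^sub>M borel"
  shows "subalgebra P (past P X k)"
    and "i \<le> k \<Longrightarrow> X i \<in> past P X k \<rightarrow>\<^sub>M borel"
proof -
  have sub: "{X i -` B \<inter> space P | i B. i \<le> k \<and> B \<in> sets borel} \<subseteq> Pow (space P)" by auto
  have "{X i -` B \<inter> space P | i B. i \<le> k \<and> B \<in> sets borel} \<subseteq> sets P"
    using measurable_sets[OF X] by auto
  then show "subalgebra P (past P X k)"
    unfolding subalgebra_def past_def
    by (simp add: space_measure_of[OF sub] sets_measure_of[OF sub] sets.sigma_sets_subset)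
  show "X i \<in> past P X k \<rightarrow>\<^sub>M borel" if "i \<le> k"
  proof (rule measurableI)
    fix B :: "'b set" assume B: "B \<in> sets borel"
    then show "X i -` B \<inter> space (past P X k) \<in> sets (past P X k)"
      unfolding past_def space_measure_of[OF sub] sets_measure_of[OF sub]
      using that by (intro sigma_sets.Basic) auto
  qed auto
qed

text \<open>The Markov property is given for indicators.  Reading the weight \<open>Z\<close> as a density, it says that the
  weighted law of \<open>X (Suc k)\<close> is the weighted law of \<open>X k\<close> transported by the kernel, an identity of
  measures, and therefore applies to all nonnegative integrands.\<close>

lemma markov_chain_one_step:
  assumes mc: "markov_chain P M \<mu> X" and kernel: "transition_kernel M"
    and Z: "Z \<in> borel_measurable (past P X k)" and Z0: "\<And>w. 0 \<le> Z w" and ZK: "\<And>w. Z w \<le> (K :: real)"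
    and f [measurable]: "f \<in> borel_measurable borel"
  shows "(\<integral>\<^sup>+w. ennreal (Z w) * f (X (Suc k) w) \<partial>P)
    = (\<integral>\<^sup>+w. ennreal (Z w) * (\<integral>\<^sup>+y. f y \<partial>M (X k w)) \<partial>P)"
proof -
  interpret prob_space P using mc by (simp add: markov_chain_def)
  have X [measurable]: "X i \<in> P \<rightarrow>\<^sub>M borel" for i using mc by (simp add: markov_chain_def)
  interpret F: finite_measure_subalgebra P "past P X k"
    by unfold_locales (rule past_subalgebra[OF X])
  have ZP [measurable]: "Z \<in> borel_measurable P"
    by (rule measurable_from_subalg[OF F.subalg Z])
  have M [measurable]: "M \<in> borel \<rightarrow>\<^sub>M subprob_algebra borel"
    using kernel unfolding transition_kernel_def by (rule measurable_prob_algebraD)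
  define D where "D j = distr (density P (\<lambda>w. ennreal (Z w))) borel (X j)" for j
  have D [measurable_cong]: "sets (D j) = sets borel" for j by (simp add: D_def)
  have MD: "M \<in> D j \<rightarrow>\<^sub>M subprob_algebra borel" for j
    using M measurable_cong_sets[OF D refl] by blast
  have ne: "space (D j) \<noteq> {}" for j by (simp add: D_def)
  have nnD: "(\<integral>\<^sup>+x. g x \<partial>D j) = (\<integral>\<^sup>+w. ennreal (Z w) * g (X j w) \<partial>P)"
    if [measurable]: "g \<in> borel_measurable borel" for g j
    by (simp add: D_def nn_integral_distr nn_integral_density)
  have "D (Suc k) = D k \<bind> M"
  proof (rule measure_eqI)
    show "sets (D (Suc k)) = sets (D k \<bind> M)"
      using sets_bind_measurable[OF MD ne] by (simp add: D)
    fix B assume "B \<in> sets (D (Suc k))"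
    then have B [measurable]: "B \<in> sets borel" by (simp add: D)
    define I :: "_ \<Rightarrow> real" where "I = indicator (X (Suc k) -` B \<inter> space P)"
    have I [measurable]: "I \<in> borel_measurable P"
      unfolding I_def by measurable
    have ZI: "integrable P (\<lambda>w. Z w * I w)"
      using Z0 ZK by (intro integrable_const_bound[of _ "K"] AE_I2) (auto simp: I_def indicator_def intro: order.trans)
    have mM: "(\<lambda>x. measure (M x) B) \<in> borel_measurable borel"
      by measurable
    have ce: "AE w in P. real_cond_exp P (past P X k) I w = measure (M (X k w)) B"
      using mc B by (simp add: markov_chain_def I_def)
    have "emeasure (D (Suc k)) B = (\<integral>\<^sup>+x. indicator B x \<partial>D (Suc k))"
      by (simp add: D)
    also have "\<dots> = (\<integral>\<^sup>+w. ennreal (Z w * I w) \<partial>P)"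
      unfolding nnD[OF borel_measurable_indicator[OF B]]
      by (intro nn_integral_cong) (auto simp: I_def indicator_def)
    also have "\<dots> = ennreal (\<integral>w. Z w * I w \<partial>P)"
      using ZI Z0 by (intro nn_integral_eq_integral) (auto simp: I_def)
    also have "(\<integral>w. Z w * I w \<partial>P) = (\<integral>w. Z w * real_cond_exp P (past P X k) I w \<partial>P)"
      using F.real_cond_exp_intg(2)[OF ZI Z I] by simp
    also have "\<dots> = (\<integral>w. Z w * measure (M (X k w)) B \<partial>P)"
      using ce mM by (intro integral_cong_AE) auto
    also have "ennreal \<dots> = (\<integral>\<^sup>+w. ennreal (Z w * measure (M (X k w)) B) \<partial>P)"
    proof (rule nn_integral_eq_integral[symmetric])
      have "AE w in P. Z w * real_cond_exp P (past P X k) I w = Z w * measure (M (X k w)) B"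
        using ce by auto
      then show "integrable P (\<lambda>w. Z w * measure (M (X k w)) B)"
        using F.real_cond_exp_intg(1)[OF ZI Z I] mM
        by (subst (asm) integrable_cong_AE) auto
    qed (use Z0 in auto)
    also have "\<dots> = (\<integral>\<^sup>+w. ennreal (Z w) * emeasure (M (X k w)) B \<partial>P)"
      using Z0 finite_measure.emeasure_eq_measure[OF prob_space.finite_measure[OF transition_kernel_prob_space[OF kernel]]]
      by (simp add: ennreal_mult')
    also have "\<dots> = (\<integral>\<^sup>+x. emeasure (M x) B \<partial>D k)"
      by (subst nnD) auto
    also have "\<dots> = emeasure (D k \<bind> M) B"
      by (rule emeasure_bind[OF ne MD B, symmetric])
    finally show "emeasure (D (Suc k)) B = emeasure (D k \<bind> M) B" .
  qed
  then have "(\<integral>\<^sup>+x. f x \<partial>D (Suc k)) = (\<integral>\<^sup>+x. \<integral>\<^sup>+y. f y \<partial>M x \<partial>D k)"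
    using nn_integral_bind[OF f MD] by simp
  then show ?thesis
    by (subst (asm) (1 2) nnD) measurable
qed

section \<open>Exponential moments of the chain\<close>

lemma exp_small_bounds:
  fixes s :: real
  assumes "0 \<le> s" "s \<le> 1/10"
  shows "exp s - 1 \<le> s * (1 + s)" "exp s * (exp s - 1) \<le> s * (1 + 3 * s)"
proof -
  have e: "exp s \<le> 1 + s + s\<^sup>2" using assms by (intro exp_bound) auto
  then show "exp s - 1 \<le> s * (1 + s)" by (simp add: algebra_simps power2_eq_square)
  have "exp s * (exp s - 1) \<le> (1 + s + s\<^sup>2) * (s * (1 + s))"
    using e assms by (intro mult_mono) (auto simp: algebra_simps power2_eq_square)
  also have "\<dots> = s * (1 + 3 * s) - s\<^sup>2 * (1 - 2 * s - s\<^sup>2)"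
    by (simp add: algebra_simps power2_eq_square)
  also have "\<dots> \<le> s * (1 + 3 * s)"
  proof -
    have "s\<^sup>2 \<le> s" using assms by (simp add: power2_eq_square mult_left_le)
    then show ?thesis using assms by simp
  qed
  finally show "exp s * (exp s - 1) \<le> s * (1 + 3 * s)" .
qed

context real_spectral_gap
begin

text \<open>Conditioning on the past of \<open>X n\<close> replaces the factor that depends on \<open>X (Suc n)\<close> by a tilted average
  evaluated at \<open>X n\<close>; the test function \<open>f\<close> is there to let the induction absorb it.\<close>

lemma markov_chain_exp_sum:
  assumes mc: "markov_chain P M \<mu> X" and \<theta>: "\<theta> \<in> A" and "f \<in> A" and "\<And>x. 0 \<le> f x"
  shows "(\<integral>\<^sup>+w. ennreal (exp (\<Sum>k=1..n. \<theta> (X k w)) * f (X n w)) \<partial>P)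
    = (\<integral>\<^sup>+x. ennreal ((tilted \<theta> ^^ n) f x) \<partial>\<mu>)"
  using assms(3,4)
proof (induction n arbitrary: f)
  case 0
  have "X 0 \<in> P \<rightarrow>\<^sub>M borel" and "\<mu> = distr P borel (X 0)"
    using mc by (auto simp: markov_chain_def)
  then show ?case
    using borel[OF 0(1)] by (simp add: nn_integral_distr)
next
  case (Suc n)
  have X: "X i \<in> P \<rightarrow>\<^sub>M borel" for i using mc by (simp add: markov_chain_def)
  have [measurable]: "\<theta> \<in> borel_measurable borel" "f \<in> borel_measurable borel"
    using borel \<theta> Suc.prems by auto
  define Z where "Z w = exp (\<Sum>k=1..n. \<theta> (X k w))" for w
  have "(\<Sum>k=1..n. \<theta> (X k w)) \<le> n * N \<theta>" for w
    using sum_bounded_above[of "{1..n}" "\<lambda>k. \<theta> (X k w)" "N \<theta>"] norm_le_nrm[OF \<theta>]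
    by (simp add: abs_le_iff)
  then have ZK: "Z w \<le> exp (n * N \<theta>)" for w by (simp add: Z_def)
  have Z: "Z \<in> borel_measurable (past P X n)"
    unfolding Z_def
    by (intro measurable_compose[OF _ borel_measurable_exp] borel_measurable_sum
        measurable_compose[OF past_subalgebra(2)[OF X]]) auto
  have fA: "(\<lambda>y. exp (\<theta> y) * f y) \<in> A"
    using \<theta> Suc.prems by (intro mult_closed exp_closed)
  have "(\<integral>\<^sup>+w. ennreal (exp (\<Sum>k=1..Suc n. \<theta> (X k w)) * f (X (Suc n) w)) \<partial>P)
      = (\<integral>\<^sup>+w. ennreal (Z w) * ennreal (exp (\<theta> (X (Suc n) w)) * f (X (Suc n) w)) \<partial>P)"
    by (simp add: Z_def exp_add mult.assoc flip: ennreal_mult')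
  also have "\<dots> = (\<integral>\<^sup>+w. ennreal (Z w) * (\<integral>\<^sup>+y. ennreal (exp (\<theta> y) * f y) \<partial>M (X n w)) \<partial>P)"
    by (rule markov_chain_one_step[OF mc kernel Z _ ZK]) (auto simp: Z_def)
  also have "\<dots> = (\<integral>\<^sup>+w. ennreal (Z w * tilted \<theta> f (X n w)) \<partial>P)"
    using nn_integral_kernel[OF fA] Suc.prems(2)
    by (simp add: tilted_def Z_def flip: ennreal_mult')
  also have "\<dots> = (\<integral>\<^sup>+x. ennreal ((tilted \<theta> ^^ n) (tilted \<theta> f) x) \<partial>\<mu>)"
    unfolding Z_def using Suc.prems
    by (intro Suc.IH tilted_closed \<theta>) (auto simp: tilted_def intro!: averaging_nonneg)
  finally show ?case by (simp add: funpow_swap1)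
qed

text \<open>To first order, stability of the cone reads \<open>(1 - \<delta>) (\<kappa> + 2 s) \<le> \<kappa>\<close> with \<open>s = N \<theta>\<close>, that is
  \<open>\<kappa> \<ge> 2 s (1 - \<delta>) / \<delta>\<close>.  Taking \<open>\<kappa> = 2 s / \<delta>\<close>, without the factor \<open>1 - \<delta>\<close>, leaves a margin that
  absorbs all higher-order terms once \<open>s\<close> is a small multiple of \<open>\<delta>\<^sup>2\<close>.  The factor \<open>0.082\<close> covers the
  values of \<open>s\<close> chosen for the concentration inequalities, the largest being about
  \<open>0.98 / 12 \<cdot> \<delta>\<^sup>2\<close>; the prefactor is then at most \<open>1 + \<kappa> \<le> 1 + 2 \<cdot> 0.082\<close>, whatever the initial law.\<close>

lemma exponential_moment_bound:
  assumes mc: "markov_chain P M \<mu> X" and \<theta>: "\<theta> \<in> A" and s: "N \<theta> \<le> 0.082 * \<delta>\<^sup>2"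
  shows "(\<integral>\<^sup>+w. ennreal (exp (\<Sum>k=1..n. \<theta> (X k w))) \<partial>P)
    \<le> ennreal (1.164 * exp (n * ((\<integral>x. \<theta> x \<partial>\<pi>) + (N \<theta>)\<^sup>2 / 2 + 2 * (N \<theta>)\<^sup>2 * (1 + 3 * N \<theta>) / \<delta>)))"
proof -
  define s where "s = N \<theta>"
  define \<kappa> where "\<kappa> = 2 * s / \<delta>"
  define e where "e = exp s - 1"
  define m where "m = (\<integral>x. \<theta> x \<partial>\<pi>)"
  have s0: "0 \<le> s" using nrm_nonneg[OF \<theta>] by (simp add: s_def)
  have \<delta>2: "\<delta>\<^sup>2 \<le> \<delta>" using gap_pos gap_le_1 by (simp add: power2_eq_square mult_left_le)
  have s1: "s \<le> 0.082 * \<delta>" "s \<le> 0.082"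
    using s \<delta>2 gap_le_1 by (auto simp: s_def)
  have \<kappa>0: "0 \<le> \<kappa>" using s0 gap_pos by (simp add: \<kappa>_def)
  have \<kappa>1: "\<kappa> \<le> 0.164 * \<delta>"
    using s gap_pos by (simp add: \<kappa>_def s_def pos_divide_le_eq power2_eq_square)
  have e0: "0 \<le> e" using s0 by (simp add: e_def)
  have e1: "e \<le> s * (1 + s)"
    unfolding e_def using exp_small_bounds(1) s0 s1 by simp
  have e2: "exp s * e \<le> s * (1 + 3 * s)"
    unfolding e_def using exp_small_bounds(2) s0 s1 by simp
  define q where "q = e * (1 + \<kappa>)"
  have "q \<le> s * ((1 + 0.082 * \<delta>) * (1 + 0.164 * \<delta>))"
  proof -
    have "q \<le> (s * (1 + s)) * (1 + \<kappa>)"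
      unfolding q_def using e1 \<kappa>0 by (intro mult_right_mono) auto
    also have "\<dots> = s * ((1 + s) * (1 + \<kappa>))" by simp
    also have "\<dots> \<le> s * ((1 + 0.082 * \<delta>) * (1 + 0.164 * \<delta>))"
      using s0 s1 \<kappa>0 \<kappa>1 gap_pos by (intro mult_left_mono mult_mono) auto
    finally show ?thesis .
  qed
  also have "(1 + 0.082 * \<delta>) * (1 + 0.164 * \<delta>) \<le> 1 + 0.26 * \<delta>"
  proof -
    have eq: "(1 + 0.082 * \<delta>) * (1 + 0.164 * \<delta>) = 1 + 0.246 * \<delta> + 0.013448 * \<delta>\<^sup>2"
      by (simp add: algebra_simps power2_eq_square)
    show ?thesis unfolding eq using \<delta>2 gap_pos by simp
  qed
  finally have q: "q \<le> s * (1 + 0.26 * \<delta>)"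
    using s0 by (simp add: mult_left_mono)
  have q0: "0 \<le> q" using e0 \<kappa>0 by (simp add: q_def)
  have q1: "q < 1"
  proof -
    have "s * (1 + 0.26 * \<delta>) \<le> 0.082 * 1.26"
      using s1 s0 gap_le_1 gap_pos by (intro mult_mono) auto
    with q show ?thesis by simp
  qed
  \<comment> \<open>The stability condition, divided by \<open>2\<close>, is \<open>q (1 - \<delta> + s / \<delta>) \<le> s\<close>, and \<open>s / \<delta> \<le> 0.082 \<delta>\<close>.\<close>
  have "q * (1 - 0.918 * \<delta>) \<le> s"
  proof -
    have "q * (1 - 0.918 * \<delta>) \<le> (s * (1 + 0.26 * \<delta>)) * (1 - 0.918 * \<delta>)"
      using q gap_le_1 by (intro mult_right_mono) auto
    also have "\<dots> = s * ((1 + 0.26 * \<delta>) * (1 - 0.918 * \<delta>))" by simp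
    also have "\<dots> \<le> s * 1"
    proof (rule mult_left_mono[OF _ s0])
      show "(1 + 0.26 * \<delta>) * (1 - 0.918 * \<delta>) \<le> 1"
        using gap_pos by (simp add: algebra_simps)
    qed
    finally show ?thesis by simp
  qed
  moreover have "q * (1 - \<delta> + s / \<delta>) \<le> q * (1 - 0.918 * \<delta>)"
  proof (rule mult_left_mono[OF _ q0])
    have "s / \<delta> \<le> 0.082 * \<delta>"
      using s gap_pos by (simp add: s_def pos_divide_le_eq power2_eq_square)
    moreover have "y \<le> 0.082 * \<delta> \<Longrightarrow> 1 - \<delta> + y \<le> 1 - 0.918 * \<delta>" for y
      by simp
    ultimately show "1 - \<delta> + s / \<delta> \<le> 1 - 0.918 * \<delta>" by blast
  qed
  ultimately have bound: "q * (1 - \<delta> + s / \<delta>) \<le> s" by (rule order.trans[rotated])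
  have stable: "(1 - \<delta>) * (\<kappa> + 2 * q) \<le> \<kappa> * (1 - q)"
  proof -
    have eq: "(1 - \<delta>) * (\<kappa> + 2 * q) - \<kappa> * (1 - q) = 2 * (q * (1 - \<delta> + s / \<delta>) - s)"
      using gap_pos by (simp add: \<kappa>_def field_simps)
    have "2 * (q * (1 - \<delta> + s / \<delta>) - s) \<le> 0"
      using bound by (intro mult_nonneg_nonpos) auto
    then show ?thesis by (simp only: eq[symmetric] diff_le_0_iff_le)
  qed
  define F where "F = (tilted \<theta> ^^ n) (\<lambda>x. 1)"
  have FC: "F \<in> mean_cone \<kappa>"
    and FI: "(\<integral>x. F x \<partial>\<pi>) \<le> exp (n * (m + s\<^sup>2 / 2 + exp s * e * \<kappa>))"
    using funpow_tilted_mean_cone[OF \<theta> \<kappa>0, of n, folded s_def, folded e_def m_def F_def]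
      q1[unfolded q_def] stable[unfolded q_def, folded mult.assoc]
    by blast+
  have "exp s * e * \<kappa> \<le> s * (1 + 3 * s) * \<kappa>"
    using e2 \<kappa>0 by (rule mult_right_mono)
  also have "\<dots> = 2 * s\<^sup>2 * (1 + 3 * s) / \<delta>" by (simp add: \<kappa>_def power2_eq_square)
  finally have "real n * (m + s\<^sup>2 / 2 + exp s * e * \<kappa>) \<le> n * (m + s\<^sup>2 / 2 + 2 * s\<^sup>2 * (1 + 3 * s) / \<delta>)"
    by (intro mult_left_mono) auto
  with FI have FI: "(\<integral>x. F x \<partial>\<pi>) \<le> exp (n * (m + s\<^sup>2 / 2 + 2 * s\<^sup>2 * (1 + 3 * s) / \<delta>))"
    by (meson exp_le_cancel_iff order_trans)
  have FB: "F x \<le> 1.164 * exp (n * (m + s\<^sup>2 / 2 + 2 * s\<^sup>2 * (1 + 3 * s) / \<delta>))" for x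
  proof -
    have "(1 + \<kappa>) * (\<integral>x. F x \<partial>\<pi>) \<le> 1.164 * exp (n * (m + s\<^sup>2 / 2 + 2 * s\<^sup>2 * (1 + 3 * s) / \<delta>))"
      using FI FC \<kappa>1 \<kappa>0 gap_le_1 by (intro mult_mono) (auto simp: mean_cone_def)
    with mean_cone_le[OF FC, of x] show ?thesis by linarith
  qed
  have "prob_space \<mu>"
    using mc prob_space.prob_space_distr[of P "X 0" borel] by (auto simp: markov_chain_def)
  moreover have "(\<integral>\<^sup>+x. ennreal (F x) \<partial>\<mu>) \<le> (\<integral>\<^sup>+x. ennreal (1.164 * exp (n * (m + s\<^sup>2 / 2 + 2 * s\<^sup>2 * (1 + 3 * s) / \<delta>))) \<partial>\<mu>)"
    by (intro nn_integral_mono ennreal_leI FB)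
  ultimately have "(\<integral>\<^sup>+x. ennreal (F x) \<partial>\<mu>) \<le> ennreal (1.164 * exp (n * (m + s\<^sup>2 / 2 + 2 * s\<^sup>2 * (1 + 3 * s) / \<delta>)))"
    by (simp add: prob_space.emeasure_space_1)
  then show ?thesis
    using markov_chain_exp_sum[OF mc \<theta> const_closed[of 1], of n] by (simp add: F_def m_def s_def)
qed

end

section \<open>Concentration of empirical means\<close>

context real_spectral_gap
begin

lemma upper_tail_bound:
  assumes mc: "markov_chain P M \<mu> X" and \<phi>: "\<phi> \<in> A" and t: "0 < t"
    and s: "t * N \<phi> \<le> 0.082 * \<delta>\<^sup>2"
  shows "measure P {w \<in> space P. (\<Sum>k=1..n. \<phi> (X k w)) \<ge> n * ((\<integral>x. \<phi> x \<partial>\<pi>) + a)}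
    \<le> 1.164 * exp (n * ((t * N \<phi>)\<^sup>2 / 2 + 2 * (t * N \<phi>)\<^sup>2 * (1 + 3 * (t * N \<phi>)) / \<delta> - t * a))"
proof -
  interpret P: prob_space P using mc by (simp add: markov_chain_def)
  have X [measurable]: "X i \<in> P \<rightarrow>\<^sub>M borel" for i using mc by (simp add: markov_chain_def)
  have [measurable]: "\<phi> \<in> borel_measurable borel" by (rule borel[OF \<phi>])
  define m where "m = (\<integral>x. \<phi> x \<partial>\<pi>)"
  define r where "r = (t * N \<phi>)\<^sup>2 / 2 + 2 * (t * N \<phi>)\<^sup>2 * (1 + 3 * (t * N \<phi>)) / \<delta>"
  have \<theta>: "(\<lambda>x. t * \<phi> x) \<in> A" by (rule scale_closed[OF \<phi>])
  have N\<theta>: "N (\<lambda>x. t * \<phi> x) = t * N \<phi>" using nrm_scale[OF \<phi>, of t] t by simp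
  have "emeasure P {w \<in> space P. (\<Sum>k=1..n. \<phi> (X k w)) \<ge> n * (m + a)}
      \<le> ennreal (exp (- t * (n * (m + a)))) * (\<integral>\<^sup>+w\<in>space P. ennreal (exp (t * (\<Sum>k=1..n. \<phi> (X k w)))) \<partial>P)"
    using t by (intro Chernoff_ineq_nn_integral_ge) auto
  also have "\<dots> \<le> ennreal (exp (- t * (n * (m + a)))) * ennreal (1.164 * exp (n * (t * m + r)))"
  proof (rule mult_left_mono)
    have "(\<integral>\<^sup>+w\<in>space P. ennreal (exp (t * (\<Sum>k=1..n. \<phi> (X k w)))) \<partial>P)
      = (\<integral>\<^sup>+w. ennreal (exp (\<Sum>k=1..n. t * \<phi> (X k w))) \<partial>P)"
      by (intro nn_integral_cong) (simp add: sum_distrib_left)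
    also have "\<dots> \<le> ennreal (1.164 * exp (n * (t * m + r)))"
      using exponential_moment_bound[OF mc \<theta>, of n] s unfolding N\<theta> by (simp add: m_def r_def add.assoc)
    finally show "(\<integral>\<^sup>+w\<in>space P. ennreal (exp (t * (\<Sum>k=1..n. \<phi> (X k w)))) \<partial>P)
      \<le> ennreal (1.164 * exp (n * (t * m + r)))" .
  qed simp
  also have "\<dots> = ennreal (1.164 * exp (n * (r - t * a)))"
    by (simp add: algebra_simps flip: ennreal_mult exp_add)
  finally show ?thesis
    unfolding m_def[symmetric] r_def[symmetric]
    by (simp add: P.emeasure_eq_measure)
qed

lemma two_sided_tail_bound:
  assumes mc: "markov_chain P M \<mu> X" and \<phi>: "\<phi> \<in> A" and t: "0 < t"
    and s: "t * N \<phi> \<le> 0.082 * \<delta>\<^sup>2" and n: "0 < n"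
  shows "measure P {w \<in> space P. \<bar>(1 / real n) * (\<Sum>k=1..n. \<phi> (X k w)) - (\<integral>x. \<phi> x \<partial>\<pi>)\<bar> \<ge> a}
    \<le> 2.328 * exp (n * ((t * N \<phi>)\<^sup>2 / 2 + 2 * (t * N \<phi>)\<^sup>2 * (1 + 3 * (t * N \<phi>)) / \<delta> - t * a))"
proof -
  interpret P: prob_space P using mc by (simp add: markov_chain_def)
  have X [measurable]: "X i \<in> P \<rightarrow>\<^sub>M borel" for i using mc by (simp add: markov_chain_def)
  have [measurable]: "\<phi> \<in> borel_measurable borel" by (rule borel[OF \<phi>])
  define m where "m = (\<integral>x. \<phi> x \<partial>\<pi>)"
  define S where "S w = (\<Sum>k=1..n. \<phi> (X k w))" for w
  define B where "B = 1.164 * exp (n * ((t * N \<phi>)\<^sup>2 / 2 + 2 * (t * N \<phi>)\<^sup>2 * (1 + 3 * (t * N \<phi>)) / \<delta> - t * a))"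
  define U where "U = {w \<in> space P. S w \<ge> n * (m + a)}"
  define L where "L = {w \<in> space P. - S w \<ge> n * (- m + a)}"
  have [measurable]: "S \<in> borel_measurable P" unfolding S_def by measurable
  have sets: "U \<in> sets P" "L \<in> sets P" unfolding U_def L_def by measurable
  have "measure P U \<le> B"
    unfolding U_def S_def m_def B_def by (rule upper_tail_bound[OF mc \<phi> t s])
  moreover have "measure P L \<le> B"
    using upper_tail_bound[OF mc uminus_closed[OF \<phi>] t, of n a] s nrm_minus[OF \<phi>]
    by (simp add: L_def S_def m_def B_def sum_negf)
  moreover have "{w \<in> space P. \<bar>(1 / real n) * S w - m\<bar> \<ge> a} \<subseteq> U \<union> L"
    using n by (auto simp: U_def L_def abs_if field_simps split: if_splits)
  then have "measure P {w \<in> space P. \<bar>(1 / real n) * S w - m\<bar> \<ge> a} \<le> measure P (U \<union> L)"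
    using sets by (intro P.finite_measure_mono) auto
  moreover have "measure P (U \<union> L) \<le> measure P U + measure P L"
    using sets by (intro measure_Un_le)
  ultimately have "measure P {w \<in> space P. \<bar>(1 / real n) * S w - m\<bar> \<ge> a} \<le> 2 * B" by linarith
  then show ?thesis by (simp add: S_def m_def B_def)
qed

text \<open>Both inequalities are one Chernoff bound with different choices of \<open>s = t \<cdot> N \<phi>\<close>.  The exponent per step is
  \<open>s\<^sup>2 / 2 + 2 s\<^sup>2 (1 + 3 s) / \<delta> - s \<rho>\<close>.  In the Gaussian regime the quadratic part is at most
  \<open>s\<^sup>2 D / (4 \<delta>)\<close> with \<open>D = 13.44 \<delta> + 8.324\<close>, and \<open>s = 2 \<delta> \<rho> / D\<close> is the minimizer of
  \<open>s\<^sup>2 D / (4 \<delta>) - s \<rho>\<close>; the condition \<open>\<rho> \<le> \<delta> / 3\<close> keeps it in the admissible range of \<open>s\<close>.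
  For the exponential bound \<open>s\<close> is held fixed near the end of that range.\<close>

lemma concentration:
  assumes mc: "markov_chain P M \<mu> X" and \<phi>: "\<phi> \<in> A" and N: "0 < N \<phi>" and n: "0 < n" and a: "0 < a"
  defines "\<rho> \<equiv> a / N \<phi>"
    and "p \<equiv> measure P {w \<in> space P. \<bar>(1 / real n) * (\<Sum>k=1..n. \<phi> (X k w)) - (\<integral>x. \<phi> x \<partial>\<pi>)\<bar> \<ge> a}"
  shows concentration_gaussian: "\<rho> \<le> \<delta> / 3 \<Longrightarrow>
      p \<le> 2.488 * exp (- real n * (\<delta> / (13.44 * \<delta> + 8.324)) * \<rho>\<^sup>2)"
    and concentration_exponential:
      "p \<le> 2.624 * exp (- real n * (0.98 * \<delta>\<^sup>2 / (12 + 13 * \<delta>)) * (\<rho> - 0.254 * \<delta>))"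
proof -
  have tail: "p \<le> 2.328 * exp (n * (s\<^sup>2 / 2 + 2 * s\<^sup>2 * (1 + 3 * s) / \<delta> - s * \<rho>))"
    if "0 < s" "s \<le> 0.082 * \<delta>\<^sup>2" for s
    using two_sided_tail_bound[OF mc \<phi> _ _ n, of "s / N \<phi>" a] that N by (simp add: p_def \<rho>_def)
  have step: "p \<le> C * exp (n * u)"
    if s: "0 < s" "s \<le> 0.082 * \<delta>\<^sup>2" and u: "s\<^sup>2 / 2 + 2 * s\<^sup>2 * (1 + 3 * s) / \<delta> - s * \<rho> \<le> u" and C: "2.328 \<le> C"
    for s u C :: real
  proof -
    have "exp (n * (s\<^sup>2 / 2 + 2 * s\<^sup>2 * (1 + 3 * s) / \<delta> - s * \<rho>)) \<le> exp (n * u)"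
      using u by (simp add: mult_left_mono)
    then have "2.328 * exp (n * (s\<^sup>2 / 2 + 2 * s\<^sup>2 * (1 + 3 * s) / \<delta> - s * \<rho>)) \<le> C * exp (n * u)"
      using C by (intro mult_mono) auto
    with tail[OF s] show ?thesis by linarith
  qed
  have \<rho>: "0 < \<rho>" using a N by (simp add: \<rho>_def)
  show "p \<le> 2.488 * exp (- real n * (\<delta> / (13.44 * \<delta> + 8.324)) * \<rho>\<^sup>2)" if small: "\<rho> \<le> \<delta> / 3"
  proof -
    define D where "D = 13.44 * \<delta> + 8.324"
    define s where "s = 2 * \<delta> * \<rho> / D"
    have D: "8.324 < D" using gap_pos by (simp add: D_def)
    have s0: "0 < s" using \<rho> gap_pos D by (simp add: s_def)
    have "2 * \<delta> * \<rho> \<le> 2 * \<delta> * (\<delta> / 3)" using small gap_pos by (intro mult_left_mono) auto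
    also have "\<dots> \<le> 0.082 * \<delta>\<^sup>2 * 8.324" by (simp add: power2_eq_square)
    also have "\<dots> \<le> 0.082 * \<delta>\<^sup>2 * D" using D by (intro mult_left_mono) auto
    finally have s1: "s \<le> 0.082 * \<delta>\<^sup>2" using D by (simp add: s_def pos_divide_le_eq)
    have "\<delta>\<^sup>2 \<le> \<delta>" using gap_pos gap_le_1 by (simp add: power2_eq_square mult_left_le)
    then have "s \<le> 0.082 * \<delta>" using s1 by simp
    then have "\<delta> / 2 + 2 * (1 + 3 * s) \<le> D / 4" using gap_pos by (simp add: D_def)
    then have "s\<^sup>2 / \<delta> * (\<delta> / 2 + 2 * (1 + 3 * s)) \<le> s\<^sup>2 / \<delta> * (D / 4)"
      using gap_pos by (intro mult_left_mono) auto
    moreover have "s\<^sup>2 / \<delta> * (\<delta> / 2 + 2 * (1 + 3 * s)) = s\<^sup>2 / 2 + 2 * s\<^sup>2 * (1 + 3 * s) / \<delta>"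
      using gap_pos by (simp add: field_simps)
    moreover have "s\<^sup>2 / \<delta> * (D / 4) - s * \<rho> = - (\<delta> / D) * \<rho>\<^sup>2"
      using gap_pos D by (simp add: s_def field_simps power2_eq_square)
    ultimately have "s\<^sup>2 / 2 + 2 * s\<^sup>2 * (1 + 3 * s) / \<delta> - s * \<rho> \<le> - (\<delta> / D) * \<rho>\<^sup>2"
      by linarith
    from step[OF s0 s1 this, of "2.488"] have "p \<le> 2.488 * exp (n * (- (\<delta> / D) * \<rho>\<^sup>2))"
      by simp
    then show ?thesis by (simp only: D_def mult.assoc mult_minus_left mult_minus_right)
  qed
  show "p \<le> 2.624 * exp (- real n * (0.98 * \<delta>\<^sup>2 / (12 + 13 * \<delta>)) * (\<rho> - 0.254 * \<delta>))"
  proof -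
    define s where "s = 0.98 * \<delta>\<^sup>2 / (12 + 13 * \<delta>)"
    have s0: "0 < s" using gap_pos by (simp add: s_def)
    have s1: "s \<le> 0.082 * \<delta>\<^sup>2"
    proof -
      have "0.98 * \<delta>\<^sup>2 \<le> 0.082 * \<delta>\<^sup>2 * (12 + 13 * \<delta>)" using gap_pos by (simp add: algebra_simps)
      then show ?thesis using gap_pos by (simp add: s_def pos_divide_le_eq)
    qed
    have \<delta>2: "\<delta>\<^sup>2 \<le> \<delta>" using gap_pos gap_le_1 by (simp add: power2_eq_square mult_left_le)
    have "s * (\<delta> / 2 + 2 * (1 + 3 * s)) \<le> (0.082 * \<delta>\<^sup>2) * 3"
      using s1 s0 \<delta>2 gap_le_1 gap_pos by (intro mult_mono) auto
    also have "\<dots> \<le> 0.254 * \<delta> * \<delta>" by (simp add: power2_eq_square)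
    finally have "s / \<delta> * (s * (\<delta> / 2 + 2 * (1 + 3 * s))) \<le> s / \<delta> * (0.254 * \<delta> * \<delta>)"
      using s0 gap_pos by (intro mult_left_mono) auto
    moreover have "s / \<delta> * (s * (\<delta> / 2 + 2 * (1 + 3 * s))) = s\<^sup>2 / 2 + 2 * s\<^sup>2 * (1 + 3 * s) / \<delta>"
      using gap_pos by (simp add: field_simps power2_eq_square)
    moreover have "s / \<delta> * (0.254 * \<delta> * \<delta>) - s * \<rho> = - s * (\<rho> - 0.254 * \<delta>)"
      using gap_pos by (simp add: field_simps)
    ultimately have "s\<^sup>2 / 2 + 2 * s\<^sup>2 * (1 + 3 * s) / \<delta> - s * \<rho> \<le> - s * (\<rho> - 0.254 * \<delta>)"
      by linarith
    from step[OF s0 s1 this, of "2.624"] show ?thesis by (simp add: s_def mult.assoc)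
  qed
qed

end

section \<open>Arbitrary scalars\<close>

lemma averaging_of_real:
  assumes "integrable (M x) f"
  shows "averaging M (\<lambda>y. of_real (f y) :: 'k::{real_normed_field, banach, second_countable_topology}) x
    = of_real (averaging M f x)"
  unfolding averaging_def by (rule integral_of_real) (use assms in simp)

theorem theorem1:
  fixes \<X> :: "('a::polish_space \<Rightarrow> 'k::{real_normed_field, banach, second_countable_topology}) set"
    and nrm :: "('a \<Rightarrow> 'k) \<Rightarrow> real"
    and M :: "'a \<Rightarrow> 'a measure"
    and \<mu>\<^sub>0 \<mu> :: "'a measure"
    and G\<^sub>0 :: "('a \<Rightarrow> 'k) set"
    and \<delta>\<^sub>0 a :: real
    and P :: "'w measure"
    and X :: "nat \<Rightarrow> 'w \<Rightarrow> 'a"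
    and \<phi> :: "'a \<Rightarrow> real"
    and n :: nat
  assumes "banach_function_algebra \<X> nrm"
    and "transition_kernel M"
    and "bounded_operator \<X> nrm (averaging M)"
    and "operator_norm \<X> nrm (averaging M) = 1"
    and "0 < \<delta>\<^sub>0" and "\<delta>\<^sub>0 \<le> 1"
    and "closed_hyperplane \<X> nrm G\<^sub>0"
    and "\<forall>f\<in>G\<^sub>0. nrm (averaging M f) \<le> (1 - \<delta>\<^sub>0) * nrm f"
    and "stationary_measure M \<mu>\<^sub>0"
    and "G\<^sub>0 = {f \<in> \<X>. (\<integral>x. f x \<partial>\<mu>\<^sub>0) = 0}"
    and "markov_chain P M \<mu> X"
    and "(\<lambda>x. of_real (\<phi> x)) \<in> \<X>"
    and "\<phi> \<noteq> (\<lambda>x. 0)"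
    and "a > 0"
    and "real n \<ge> 1 + ln 100 / (- ln (1 - \<delta>\<^sub>0 / 13))"
  defines "\<rho> \<equiv> a / nrm (\<lambda>x. of_real (\<phi> x))"
    and "p \<equiv> measure P {w \<in> space P.
                \<bar>(1 / real n) * (\<Sum>k=1..n. \<phi> (X k w)) - (\<integral>x. \<phi> x \<partial>\<mu>\<^sub>0)\<bar> \<ge> a}"
  shows "(\<rho> \<le> \<delta>\<^sub>0 / 3 \<longrightarrow>
            p \<le> 2.488 * exp (- real n * (\<delta>\<^sub>0 / (13.44 * \<delta>\<^sub>0 + 8.324)) * \<rho>\<^sup>2)) \<and>
         (\<rho> > \<delta>\<^sub>0 / 3 \<longrightarrow>
            p \<le> 2.624 * exp (- real n * (0.98 * \<delta>\<^sub>0\<^sup>2 / (12 + 13 * \<delta>\<^sub>0)) * (\<rho> - 0.254 * \<delta>\<^sub>0)))"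
proof -
  interpret X: banach_function_algebra \<X> nrm by fact
  define A where "A = {f :: 'a \<Rightarrow> real. (\<lambda>x. of_real (f x)) \<in> \<X>}"
  define N where "N = (\<lambda>f :: 'a \<Rightarrow> real. nrm (\<lambda>x. of_real (f x)))"
  interpret A: banach_function_algebra A N
    unfolding A_def N_def by (rule X.real_valued_subalgebra)
  have averaging: "averaging M (\<lambda>x. of_real (f x) :: 'k) = (\<lambda>x. of_real (averaging M f x))"
    if "f \<in> A" for f
    using that A.integrable_member transition_kernel_prob_space[OF assms(2)] transition_kernel_sets[OF assms(2)]
    by (intro ext averaging_of_real) auto
  interpret A: real_spectral_gap A N M \<mu>\<^sub>0 \<delta>\<^sub>0
  proof
    fix f assume f: "f \<in> A"
    then have fX: "(\<lambda>x. of_real (f x)) \<in> \<X>" by (simp add: A_def)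
    then show "averaging M f \<in> A"
      using assms(3) averaging[OF f] by (auto simp: bounded_operator_def A_def)
    have "integrable \<mu>\<^sub>0 f"
      using assms(9) by (intro A.integrable_member f) (auto simp: stationary_measure_def space_prob_algebra)
    then have "(\<integral>x. of_real (f x) \<partial>\<mu>\<^sub>0) = (of_real (\<integral>x. f x \<partial>\<mu>\<^sub>0) :: 'k)"
      by simp
    then show "N (averaging M f) \<le> (1 - \<delta>\<^sub>0) * N f" if "(\<integral>x. f x \<partial>\<mu>\<^sub>0) = 0"
      using assms(8,10) that fX averaging[OF f] by (auto simp: N_def)
  qed (use assms in auto)
  have \<phi>: "\<phi> \<in> A" using assms by (simp add: A_def)
  have N\<phi>: "0 < N \<phi>"
  proof -
    obtain x where "\<phi> x \<noteq> 0" using assms by auto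
    then show ?thesis using A.norm_le_nrm[OF \<phi>, of x] by simp
  qed
  have n: "0 < n"
  proof -
    have "ln (1 - \<delta>\<^sub>0 / 13) \<le> 0" using assms by (intro ln_le_zero_iff[THEN iffD2]) auto
    then have "0 \<le> ln 100 / (- ln (1 - \<delta>\<^sub>0 / 13))" by (intro divide_nonneg_nonneg) auto
    with assms(15) have "0 < real n" by linarith
    then show ?thesis by simp
  qed
  show ?thesis
    using A.concentration[OF assms(11) \<phi> N\<phi> n \<open>a > 0\<close>]
    unfolding \<rho>_def p_def N_def by blast
qed

end
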